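(* Let $X$ be a Banach space with the property $\beta$, witnessed by sets $\{x_\alpha: \alpha\in \Lambda\}\subset S_X$, $\{x^*_\alpha: \alpha\in \Lambda\}\subset S_{X^*}$ and a number $\rho\in[0,1)$. Then $X \in \mathrm{ACK}_\rho$ with the same value of $\rho$ and with corresponding $1$-norming set $\Gamma=\{x_\alpha^*: \alpha \in \Lambda\}$. Moreover, if $X$ has property $\beta$ with $\rho = 0$, then $X \in \mathrm{ACK}$.
   Context: Banach spaces are over $\mathbb{K}\in\{\mathbb{R},\mathbb{C}\}$. Property $\beta$: $X$ has property $\beta$ if there exist $\{x_\alpha: \alpha\in \Lambda\}\subset S_X$, $\{x^*_\alpha: \alpha\in \Lambda\}\subset S_{X^*}$ and $\rho\in[0,1)$ such that (i) $x^*_\alpha(x_\alpha) = 1$; (ii) $|x^*_\alpha(x_\gamma)| \leq \rho < 1$ if $\alpha \neq \gamma$; (iii) $\|x\| = \sup\{|x_\alpha^*(x)|: \alpha \in \Lambda\}$ for all $x\in X$. $B_X$, $S_X$ are the closed unit ball and unit sphere; $L(X)$ is the space of bounded linear operators on $X$; $w^*$ is the weak-star topology; $\mathrm{aco}\{0,V\}$ is the absolutely convex hull of $V\cup\{0\}$. A set $\Gamma\subset B_{X^*}$ is $1$-norming if $\|x\|=\sup_{x^*\in\Gamma}|x^*(x)|$ for all $x\in X$. ACK structure. For $\rho\in[0,1)$, $X\in\mathrm{ACK}_\rho$ if there is a $1$-norming set $\Gamma\subset B_{X^*}$ (the corresponding $1$-norming set) such that for every $\varepsilon>0$ and every non-empty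 relatively $w^*$-open $U\subset\Gamma$ there exist a non-empty $V\subset U$, vectors $x_1^*\in V$, $e\in S_X$ and an operator $F\in L(X)$ with: (I) $\|Fe\|=\|F\|=1$; (II) $x_1^*(Fe)=1$; (III) $F^*x_1^*=x_1^*$; (IV) denoting $V_1=\{x^*\in\Gamma:\|F^*x^*\|+(1-\varepsilon)\|(I_{X^*}-F^* )(x^* )\|\le 1\}$, one has $|v^*(Fe)|\le\rho$ for every $v^*\in\Gamma\setminus V_1$; (V) $\mathrm{dist}(F^*x^*,\mathrm{aco}\{0,V\})<\varepsilon$ for every $x^*\in\Gamma$; (VI) $|v^*(e)-1|\le\varepsilon$ for every $v^*\in V$. $X\in\mathrm{ACK}$ (simple ACK structure) if the same holds with (IV) replaced by $V_1=\Gamma$. *)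

theory Defs
  imports "HOL-Analysis.Analysis"
begin

text \<open>
  A Banach space over \<open>\<real>\<close> or \<open>\<complex>\<close> is a type of class \<^class>\<open>banach\<close> together with a compatible
  multiplication \<open>s\<close> by scalars from a type \<open>'k\<close> of class \<^class>\<open>real_normed_field\<close>. The norm of such
  a field is multiplicative, so by the Gelfand--Mazur theorem \<open>'k\<close> is \<open>\<real>\<close> or \<open>\<complex>\<close> up to isometric
  isomorphism; real and complex spaces are the instances \<open>'k = real\<close> and \<open>'k = complex\<close>.
\<close>

locale banach_over = vector_space s
  for s :: "'k::real_normed_field \<Rightarrow> 'a::banach \<Rightarrow> 'a" +
  assumes scale_of_real: "s (of_real r) x = r *\<^sub>R x"
    and norm_scale: "norm (s c x) = norm c * norm x"

lemma banach_over_scaleR: "banach_over (scaleR :: real \<Rightarrow> 'a::banach \<Rightarrow> 'a)"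
  by unfold_locales (auto simp: algebra_simps)

lemma banach_over_mult: "banach_over ((*) :: complex \<Rightarrow> complex \<Rightarrow> complex)"
  by unfold_locales (auto simp: algebra_simps norm_mult scaleR_conv_of_real)

text \<open>
  \<open>X\<^sup>*\<close> and \<open>L(X)\<close> are sets of plain functions. Their norms are given by \<^const>\<open>onorm\<close>, the adjoint of
  \<open>F\<close> is \<open>f \<mapsto> f \<circ> F\<close>, and the vector operations of \<open>X\<^sup>*\<close> are written out pointwise.
\<close>

definition dual :: "('k::real_normed_field \<Rightarrow> 'a::banach \<Rightarrow> 'a) \<Rightarrow> ('a \<Rightarrow> 'k) set"
  where "dual s = {f. Vector_Spaces.linear s (*) f \<and> bounded_linear f}"

definition operators :: "('k::real_normed_field \<Rightarrow> 'a::banach \<Rightarrow> 'a) \<Rightarrow> ('a \<Rightarrow> 'a) set"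
  where "operators s = {F. Vector_Spaces.linear s s F \<and> bounded_linear F}"

definition weak_star :: "('k::real_normed_field \<Rightarrow> 'a::banach \<Rightarrow> 'a) \<Rightarrow> ('a \<Rightarrow> 'k) topology"
  where "weak_star s = topology_generated_by {{f \<in> dual s. f x \<in> W} | x W. open W}"

definition absolutely_convex :: "('a \<Rightarrow> 'k::real_normed_field) set \<Rightarrow> bool"
  where "absolutely_convex A \<longleftrightarrow>
    (\<forall>f\<in>A. \<forall>g\<in>A. \<forall>a b. norm a + norm b \<le> 1 \<longrightarrow> (\<lambda>x. a * f x + b * g x) \<in> A)"

definition aco :: "('a \<Rightarrow> 'k::real_normed_field) set \<Rightarrow> ('a \<Rightarrow> 'k) set"
  where "aco A = absolutely_convex hull A"

definition dual_dist ::
    "('a::real_normed_vector \<Rightarrow> 'k::real_normed_field) \<Rightarrow> ('a \<Rightarrow> 'k) set \<Rightarrow> real"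
  where "dual_dist f A = (INF g\<in>A. onorm (\<lambda>x. f x - g x))"

text \<open>
  Suprema of absolute values are taken in \<open>[0,\<infinity>]\<close>, so that the supremum over the empty set, which
  occurs when \<open>X = {0}\<close>, is \<open>0\<close>.
\<close>

definition one_norming ::
    "('k::real_normed_field \<Rightarrow> 'a::banach \<Rightarrow> 'a) \<Rightarrow> ('a \<Rightarrow> 'k) set \<Rightarrow> bool"
  where "one_norming s \<Gamma> \<longleftrightarrow>
    \<Gamma> \<subseteq> {f \<in> dual s. onorm f \<le> 1} \<and>
    (\<forall>x. ennreal (norm x) = (SUP f\<in>\<Gamma>. ennreal (norm (f x))))"

definition property_beta ::
    "('k::real_normed_field \<Rightarrow> 'a::banach \<Rightarrow> 'a) \<Rightarrow>
     'i set \<Rightarrow> ('i \<Rightarrow> 'a) \<Rightarrow> ('i \<Rightarrow> 'a \<Rightarrow> 'k) \<Rightarrow> real \<Rightarrow> bool"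
  where "property_beta s \<Lambda> x x' \<rho> \<longleftrightarrow>
    0 \<le> \<rho> \<and> \<rho> < 1 \<and>
    x ` \<Lambda> \<subseteq> sphere 0 1 \<and>
    x' ` \<Lambda> \<subseteq> {f \<in> dual s. onorm f = 1} \<and>
    (\<forall>\<alpha>\<in>\<Lambda>. x' \<alpha> (x \<alpha>) = 1) \<and>
    (\<forall>\<alpha>\<in>\<Lambda>. \<forall>\<gamma>\<in>\<Lambda>. \<alpha> \<noteq> \<gamma> \<longrightarrow> norm (x' \<alpha> (x \<gamma>)) \<le> \<rho>) \<and>
    (\<forall>y. ennreal (norm y) = (SUP \<alpha>\<in>\<Lambda>. ennreal (norm (x' \<alpha> y))))"

definition V1 ::
    "('a \<Rightarrow> 'k) set \<Rightarrow> real \<Rightarrow> ('a \<Rightarrow> 'a) \<Rightarrow> ('a::real_normed_vector \<Rightarrow> 'k::real_normed_field) set"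
  where "V1 \<Gamma> \<epsilon> F =
    {f \<in> \<Gamma>. onorm (f \<circ> F) + (1 - \<epsilon>) * onorm (\<lambda>x. f x - (f \<circ> F) x) \<le> 1}"

text \<open>
  The requirements common to \<open>ACK\<^sub>\<rho>\<close> and \<open>ACK\<close>; the two structures differ only in the condition on \<open>V1\<close>.
\<close>

definition ACK_data ::
    "('k::real_normed_field \<Rightarrow> 'a::banach \<Rightarrow> 'a) \<Rightarrow> ('a \<Rightarrow> 'k) set \<Rightarrow> real \<Rightarrow> ('a \<Rightarrow> 'k) set \<Rightarrow>
     ('a \<Rightarrow> 'k) set \<Rightarrow> ('a \<Rightarrow> 'k) \<Rightarrow> 'a \<Rightarrow> ('a \<Rightarrow> 'a) \<Rightarrow> bool"
  where "ACK_data s \<Gamma> \<epsilon> U V f1 e F \<longleftrightarrow>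
    V \<noteq> {} \<and> V \<subseteq> U \<and> f1 \<in> V \<and> e \<in> sphere 0 1 \<and> F \<in> operators s \<and>
    norm (F e) = 1 \<and> onorm F = 1 \<and>
    f1 (F e) = 1 \<and>
    f1 \<circ> F = f1 \<and>
    (\<forall>f\<in>\<Gamma>. dual_dist (f \<circ> F) (aco (insert (\<lambda>_. 0) V)) < \<epsilon>) \<and>
    (\<forall>v\<in>V. norm (v e - 1) \<le> \<epsilon>)"

definition ACK_rho_with ::
    "('k::real_normed_field \<Rightarrow> 'a::banach \<Rightarrow> 'a) \<Rightarrow> real \<Rightarrow> ('a \<Rightarrow> 'k) set \<Rightarrow> bool"
  where "ACK_rho_with s \<rho> \<Gamma> \<longleftrightarrow>
    0 \<le> \<rho> \<and> \<rho> < 1 \<and> one_norming s \<Gamma> \<and>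
    (\<forall>\<epsilon>>0. \<forall>U. openin (subtopology (weak_star s) \<Gamma>) U \<and> U \<noteq> {} \<longrightarrow>
      (\<exists>V f1 e F. ACK_data s \<Gamma> \<epsilon> U V f1 e F \<and>
        (\<forall>v \<in> \<Gamma> - V1 \<Gamma> \<epsilon> F. norm (v (F e)) \<le> \<rho>)))"

definition ACK_rho :: "('k::real_normed_field \<Rightarrow> 'a::banach \<Rightarrow> 'a) \<Rightarrow> real \<Rightarrow> bool"
  where "ACK_rho s \<rho> \<longleftrightarrow> (\<exists>\<Gamma>. ACK_rho_with s \<rho> \<Gamma>)"

definition ACK :: "('k::real_normed_field \<Rightarrow> 'a::banach \<Rightarrow> 'a) \<Rightarrow> bool"
  where "ACK s \<longleftrightarrow>
    (\<exists>\<Gamma>. one_norming s \<Gamma> \<and>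
      (\<forall>\<epsilon>>0. \<forall>U. openin (subtopology (weak_star s) \<Gamma>) U \<and> U \<noteq> {} \<longrightarrow>
        (\<exists>V f1 e F. ACK_data s \<Gamma> \<epsilon> U V f1 e F \<and> V1 \<Gamma> \<epsilon> F = \<Gamma>)))"

end

theory Submission imports Defs begin

text \<open>
  Every point \<open>f = x'\<^sub>\<alpha>\<close> of a non-empty open set \<open>U\<close> carries the required data already on the
  singleton \<open>V = {f}\<close>. Put \<open>e = x\<^sub>\<alpha>\<close> and let \<open>F = f \<otimes> e\<close> be the rank-one operator \<open>y \<mapsto> f(y) e\<close>.
  Since \<open>f(e) = 1 = \<parallel>f\<parallel> = \<parallel>e\<parallel>\<close>, it is a norm-one projection onto the line through \<open>e\<close>, and its
  adjoint is \<open>g \<mapsto> g(e) f\<close>. Hence the adjoint fixes \<open>f\<close> and maps the whole dual ball into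
  \<open>aco {0, f}\<close>, so the distances to that set are not merely small but \<open>0\<close>; this is lemma
  \<open>ACK_data_rank_one\<close>.

  It remains to bound \<open>v(F e) = v(x\<^sub>\<alpha>)\<close> for \<open>v\<close> in \<open>\<Gamma>\<close> outside \<open>V\<^sub>1\<close>. The functional \<open>f\<close> lies in
  \<open>V\<^sub>1\<close> because the adjoint fixes it. So \<open>v = x'\<^sub>\<gamma>\<close> with \<open>\<gamma> \<noteq> \<alpha>\<close>, and the bound \<open>\<rho>\<close> is exactly the
  off-diagonal estimate in property \<open>\<beta>\<close>. When \<open>\<rho> = 0\<close>, the adjoint annihilates these other
  functionals, and a functional \<open>g\<close> of norm at most \<open>1\<close> with \<open>g \<circ> F = 0\<close> lies in \<open>V\<^sub>1\<close>: the
  inequality defining \<open>V\<^sub>1\<close> reads \<open>(1 - \<epsilon>) \<parallel>g\<parallel> \<le> 1\<close>. Hence \<open>V\<^sub>1 = \<Gamma>\<close>.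
\<close>

lemma absolutely_convex_aco:
  fixes A :: "('a \<Rightarrow> 'k::real_normed_field) set"
  shows "absolutely_convex (aco A)"
  unfolding aco_def
proof (rule hull_in)
  show "absolutely_convex (\<Inter>T)" if "Ball T absolutely_convex" for T :: "('a \<Rightarrow> 'k) set set"
    using that unfolding absolutely_convex_def by blast
qed

lemma scaled_mem_aco_insert_zero:
  fixes f :: "'a \<Rightarrow> 'k::real_normed_field"
  assumes "f \<in> A" "norm c \<le> 1"
  shows "(\<lambda>x. c * f x) \<in> aco (insert (\<lambda>_. 0) A)"
proof -
  have "f \<in> aco (insert (\<lambda>_. 0) A)" "(\<lambda>_. 0) \<in> aco (insert (\<lambda>_. 0) A)"
    using assms(1) by (auto simp: aco_def intro: hull_inc)
  moreover have "norm c + norm (0::'k) \<le> 1"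
    using assms(2) by simp
  ultimately have "(\<lambda>x. c * f x + 0 * (\<lambda>_. 0) x) \<in> aco (insert (\<lambda>_. 0) A)"
    by (rule absolutely_convex_aco[unfolded absolutely_convex_def, rule_format])
  then show ?thesis by simp
qed

lemma bounded_linear_if_mem_aco:
  fixes A :: "('a::real_normed_vector \<Rightarrow> 'k::real_normed_field) set"
  assumes "\<And>f. f \<in> A \<Longrightarrow> bounded_linear f" "g \<in> aco A"
  shows "bounded_linear g"
proof -
  have "absolutely_convex {f :: 'a \<Rightarrow> 'k. bounded_linear f}"
    unfolding absolutely_convex_def
    by (auto intro!: bounded_linear_add bounded_linear_const_mult)
  then have "aco A \<subseteq> {f. bounded_linear f}"
    unfolding aco_def using assms(1) by (intro hull_minimal) auto
  with assms(2) show ?thesis by blast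
qed

text \<open>
  The infimum in \<^const>\<open>dual_dist\<close> is one of real numbers, hence meaningful only when bounded below.
  The boundedness hypotheses ensure that every \<^const>\<open>onorm\<close> involved is nonnegative.
\<close>

lemma dual_dist_eq_zero_if_mem:
  assumes "f \<in> A" "\<And>g. g \<in> A \<Longrightarrow> bounded_linear g"
  shows "dual_dist f A = 0"
  unfolding dual_dist_def
proof (rule cInf_eq_minimum)
  have "onorm (\<lambda>x. f x - f x) = 0"
    by (simp add: onorm_zero)
  then show "0 \<in> (\<lambda>g. onorm (\<lambda>x. f x - g x)) ` A"
    using assms(1) by (intro image_eqI[where x = f]) simp_all
  show "0 \<le> r" if "r \<in> (\<lambda>g. onorm (\<lambda>x. f x - g x)) ` A" for r
    using that assms by (auto intro!: onorm_pos_le bounded_linear_sub)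
qed

lemma dual_apply_scale: "f \<in> dual s \<Longrightarrow> f (s c y) = c * f y"
  unfolding dual_def using linear_iff_module_hom module_hom.scale by blast

lemma norm_dual_apply_le: "f \<in> dual s \<Longrightarrow> norm (f y) \<le> onorm f * norm y"
  by (simp add: dual_def onorm)

lemma rank_one_in_operators:
  assumes "banach_over s" "f \<in> dual s"
  shows "(\<lambda>y. s (f y) e) \<in> operators s"
proof -
  interpret banach_over s by fact
  have f: "bounded_linear f" using assms(2) by (simp add: dual_def)
  interpret f: bounded_linear f by fact
  have "Vector_Spaces.linear s s (\<lambda>y. s (f y) e)"
    using dual_apply_scale[OF assms(2)]
    by unfold_locales (simp_all add: f.add scale_left_distrib)
  moreover have "bounded_linear (\<lambda>y. s (f y) e)"
  proof (rule bounded_linear_intro)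
    show "s (f (y + z)) e = s (f y) e + s (f z) e" for y z
      by (simp add: f.add scale_left_distrib)
    show "s (f (r *\<^sub>R y)) e = r *\<^sub>R s (f y) e" for r y
      by (simp add: f.scaleR scaleR_conv_of_real scale_of_real flip: scale_scale)
    show "norm (s (f y) e) \<le> norm y * (onorm f * norm e)" for y
      using mult_right_mono[OF norm_dual_apply_le[OF assms(2), of y] norm_ge_zero[of e]]
      by (simp add: norm_scale ac_simps)
  qed
  ultimately show ?thesis by (simp add: operators_def)
qed

lemma onorm_rank_one:
  assumes "banach_over s" "f \<in> dual s" "onorm f = 1" "norm e = 1" "f e = 1"
  shows "onorm (\<lambda>y. s (f y) e) = 1"
proof (rule antisym)
  interpret banach_over s by fact
  show "onorm (\<lambda>y. s (f y) e) \<le> 1"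
    using norm_dual_apply_le[OF assms(2)] assms(3,4)
    by (intro onorm_bound) (auto simp: norm_scale)
  have "bounded_linear (\<lambda>y. s (f y) e)"
    using rank_one_in_operators[OF assms(1,2)] by (simp add: operators_def)
  then show "1 \<le> onorm (\<lambda>y. s (f y) e)"
    using onorm[of "\<lambda>y. s (f y) e" e] assms(4,5) by simp
qed

lemma comp_rank_one:
  assumes "g \<in> dual s"
  shows "g \<circ> (\<lambda>y. s (f y) e) = (\<lambda>y. g e * f y)"
  using dual_apply_scale[OF assms] by (auto simp: mult.commute)

text \<open>
  The distance condition holds because \<open>g \<circ> F = g(e) f\<close> with \<open>\<bar>g(e)\<bar> \<le> \<parallel>g\<parallel> \<parallel>e\<parallel> \<le> 1\<close>, which is a point
  of \<open>aco {0, f}\<close>. For \<open>g = f\<close> the same formula says that the adjoint fixes \<open>f\<close>.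
\<close>

lemma ACK_data_rank_one:
  fixes s :: "'k::real_normed_field \<Rightarrow> 'a::banach \<Rightarrow> 'a"
  assumes "banach_over s" "\<Gamma> \<subseteq> {g \<in> dual s. onorm g \<le> 1}" "f \<in> \<Gamma>" "f \<in> U"
    and "onorm f = 1" "norm e = 1" "f e = 1" "\<epsilon> > 0"
  shows "ACK_data s \<Gamma> \<epsilon> U {f} f e (\<lambda>y. s (f y) e)"
proof -
  interpret banach_over s by fact
  have f: "f \<in> dual s" using assms by blast
  have "dual_dist (g \<circ> (\<lambda>y. s (f y) e)) (aco {\<lambda>_. 0, f}) = 0" if "g \<in> \<Gamma>" for g
  proof (rule dual_dist_eq_zero_if_mem)
    have g: "g \<in> dual s" "onorm g \<le> 1" using that assms(2) by auto
    have "norm (g e) \<le> 1"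
      using norm_dual_apply_le[OF g(1), of e] g(2) assms(6) by simp
    then show "g \<circ> (\<lambda>y. s (f y) e) \<in> aco {\<lambda>_. 0, f}"
      unfolding comp_rank_one[OF g(1)] by (intro scaled_mem_aco_insert_zero) auto
    show "bounded_linear h" if "h \<in> aco {\<lambda>_. 0, f}" for h
      using that f by (auto simp: dual_def intro: bounded_linear_if_mem_aco[rotated])
  qed
  moreover have "f \<circ> (\<lambda>y. s (f y) e) = f"
    unfolding comp_rank_one[OF f] using assms(7) by simp
  ultimately show ?thesis
    unfolding ACK_data_def
    using assms rank_one_in_operators[OF assms(1) f] onorm_rank_one[OF assms(1) f]
    by simp
qed

lemma mem_V1_if_comp_eq_self:
  assumes "f \<in> \<Gamma>" "f \<circ> F = f" "onorm f \<le> 1"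
  shows "f \<in> V1 \<Gamma> \<epsilon> F"
  using assms(1,3) unfolding V1_def mem_Collect_eq assms(2) by (simp add: onorm_zero)

lemma mem_V1_if_comp_eq_zero:
  assumes "g \<in> \<Gamma>" "g \<circ> F = (\<lambda>_. 0)" "bounded_linear g" "onorm g \<le> 1" "\<epsilon> > 0"
  shows "g \<in> V1 \<Gamma> \<epsilon> F"
proof -
  (* 1 - \<epsilon> may be negative, so the product is estimated as onorm g - \<epsilon> * onorm g. *)
  have "0 \<le> \<epsilon> * onorm g"
    using assms(3,5) by (simp add: onorm_pos_le)
  then have "(1 - \<epsilon>) * onorm g \<le> 1"
    using assms(4) unfolding left_diff_distrib by linarith
  then show ?thesis
    using assms(1) unfolding V1_def mem_Collect_eq assms(2) by (simp add: onorm_zero)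
qed

theorem theorem4p9:
  fixes s :: "'k::real_normed_field \<Rightarrow> 'a::banach \<Rightarrow> 'a"
    and \<Lambda> :: "'i set" and x :: "'i \<Rightarrow> 'a" and x' :: "'i \<Rightarrow> 'a \<Rightarrow> 'k" and \<rho> :: real
  assumes "banach_over s"
    and "property_beta s \<Lambda> x x' \<rho>"
  shows "ACK_rho s \<rho> \<and> ACK_rho_with s \<rho> (x' ` \<Lambda>) \<and> (\<rho> = 0 \<longrightarrow> ACK s)"
proof -
  interpret banach_over s by fact
  let ?\<Gamma> = "x' ` \<Lambda>"
  have norm_x: "norm (x \<alpha>) = 1" if "\<alpha> \<in> \<Lambda>" for \<alpha>
    using assms(2) that by (auto simp: property_beta_def)
  have \<rho>: "0 \<le> \<rho>" "\<rho> < 1"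
    using assms(2) by (auto simp: property_beta_def)
  have x'_dual: "x' \<alpha> \<in> dual s" and onorm_x': "onorm (x' \<alpha>) = 1"
    and x'_x: "x' \<alpha> (x \<alpha>) = 1" if "\<alpha> \<in> \<Lambda>" for \<alpha>
    using assms(2) that by (auto simp: property_beta_def)
  have off_diagonal: "norm (x' \<alpha> (x \<gamma>)) \<le> \<rho>" if "\<alpha> \<in> \<Lambda>" "\<gamma> \<in> \<Lambda>" "\<alpha> \<noteq> \<gamma>" for \<alpha> \<gamma>
    using assms(2) that by (auto simp: property_beta_def)
  have norming: "one_norming s ?\<Gamma>"
    using assms(2) by (auto simp: property_beta_def one_norming_def image_image)
  have ack: "\<exists>V f1 e F. ACK_data s ?\<Gamma> \<epsilon> U V f1 e F \<and>
      (\<forall>v \<in> ?\<Gamma> - V1 ?\<Gamma> \<epsilon> F. norm (v (F e)) \<le> \<rho>) \<and> (\<rho> = 0 \<longrightarrow> V1 ?\<Gamma> \<epsilon> F = ?\<Gamma>)"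
    if "\<epsilon> > 0" and U: "openin (subtopology (weak_star s) ?\<Gamma>) U" "U \<noteq> {}" for \<epsilon> U
  proof -
    from U obtain \<alpha> where \<alpha>: "\<alpha> \<in> \<Lambda>" "x' \<alpha> \<in> U"
      using openin_subset[OF U(1)] by auto
    define F where "F = (\<lambda>y. s (x' \<alpha> y) (x \<alpha>))"
    have data: "ACK_data s ?\<Gamma> \<epsilon> U {x' \<alpha>} (x' \<alpha>) (x \<alpha>) F"
      unfolding F_def using \<alpha> \<open>\<epsilon> > 0\<close> norming
      by (intro ACK_data_rank_one assms(1))
        (auto simp: one_norming_def norm_x onorm_x' x'_x)
    have Fx: "F (x \<alpha>) = x \<alpha>"
      using x'_x[OF \<alpha>(1)] by (simp add: F_def)
    have "x' \<alpha> \<circ> F = x' \<alpha>"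
      using data by (simp add: ACK_data_def)
    then have self: "x' \<alpha> \<in> V1 ?\<Gamma> \<epsilon> F"
      using \<alpha> onorm_x' by (intro mem_V1_if_comp_eq_self) auto
    have small: "norm (v (F (x \<alpha>))) \<le> \<rho>" if "v \<in> ?\<Gamma> - V1 ?\<Gamma> \<epsilon> F" for v
      using that self Fx off_diagonal \<alpha>(1) by auto
    have "x' \<gamma> \<in> V1 ?\<Gamma> \<epsilon> F" if "\<rho> = 0" "\<gamma> \<in> \<Lambda>" for \<gamma>
    proof (cases "\<gamma> = \<alpha>")
      case False
      then have "x' \<gamma> (x \<alpha>) = 0"
        using off_diagonal[of \<gamma> \<alpha>] that \<alpha>(1) by simp
      then have "x' \<gamma> \<circ> F = (\<lambda>_. 0)"
        unfolding F_def comp_rank_one[OF x'_dual[OF that(2)]] by simp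
      then show ?thesis
        using that(2) onorm_x' x'_dual \<open>\<epsilon> > 0\<close>
        by (intro mem_V1_if_comp_eq_zero) (auto simp: dual_def)
    qed (use self in simp)
    then have "\<rho> = 0 \<longrightarrow> V1 ?\<Gamma> \<epsilon> F = ?\<Gamma>"
      by (auto simp: V1_def)
    with data small show ?thesis by blast
  qed
  have "ACK_rho_with s \<rho> ?\<Gamma>"
    unfolding ACK_rho_with_def
  proof (intro conjI allI impI \<rho> norming)
    fix \<epsilon> :: real and U
    assume "\<epsilon> > 0" and U: "openin (subtopology (weak_star s) ?\<Gamma>) U \<and> U \<noteq> {}"
    from ack[OF this(1) conjunct1[OF U] conjunct2[OF U]]
    show "\<exists>V f1 e F. ACK_data s ?\<Gamma> \<epsilon> U V f1 e F \<and>
        (\<forall>v \<in> ?\<Gamma> - V1 ?\<Gamma> \<epsilon> F. norm (v (F e)) \<le> \<rho>)"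
      by (elim exE conjE) (intro exI conjI)
  qed
  moreover have "ACK s" if "\<rho> = 0"
    unfolding ACK_def
  proof (rule exI[of _ ?\<Gamma>], intro conjI allI impI norming)
    fix \<epsilon> :: real and U
    assume "\<epsilon> > 0" and U: "openin (subtopology (weak_star s) ?\<Gamma>) U \<and> U \<noteq> {}"
    from ack[OF this(1) conjunct1[OF U] conjunct2[OF U]] that
    show "\<exists>V f1 e F. ACK_data s ?\<Gamma> \<epsilon> U V f1 e F \<and> V1 ?\<Gamma> \<epsilon> F = ?\<Gamma>"
      by (elim exE conjE) (intro exI conjI, assumption, erule mp)
  qed
  ultimately show ?thesis
    unfolding ACK_rho_def by blast
qed

end
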